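(* Let $\tau>0$, let $\boldsymbol{A}=\boldsymbol{A}^{\mathrm{SI}}\in\mathbb{C}^{n\times n}$ be the Hermitian matrix learned by the semi-implicit DMD (SI-DMD) from snapshot data with time step $\tau$ (see context), and let $\{\boldsymbol{x}_k\}_{k\ge0}\subset\mathbb{C}^n$ be the SI-DMD iterates with initial states $\boldsymbol{x}_0,\boldsymbol{x}_1\in\mathbb{C}^n$, i.e. $$\boldsymbol{x}_{k+1}=\bigl(\boldsymbol{I}+\imath\tau\boldsymbol{A}\bigr)^{-1}\bigl(\boldsymbol{I}-\imath\tau\boldsymbol{A}\bigr)\boldsymbol{x}_{k-1},\qquad k\ge1.$$ Then SI-DMD preserves the discretized mass: for any nonnegative integer $k$, $$\|\boldsymbol{x}_{2k}\|_2=\|\boldsymbol{x}_0\|_2,\qquad\|\boldsymbol{x}_{2k+1}\|_2=\|\boldsymbol{x}_1\|_2.$$ In addition, it preserves the discretized quadratic energy functional $E(\boldsymbol{x})=\boldsymbol{x}^*\boldsymbol{A}\boldsymbol{x}$ associated with $\boldsymbol{A}$: for any nonnegative integer $k$, $$E(\boldsymbol{x}_{2k})=E(\boldsymbol{x}_0),\qquad E(\boldsymbol{x}_{2k+1})=E(\boldsymbol{x}_1).$$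
   Context: Here $\imath$ is the imaginary unit, $\boldsymbol{I}$ the $n\times n$ identity, $^*$ the conjugate transpose, $\|\cdot\|_2$ the Euclidean norm, $\|\cdot\|_{\mathrm F}$ the Frobenius norm. SI-DMD: given snapshots $\boldsymbol{y}_0,\dots,\boldsymbol{y}_{m+1}\in\mathbb{C}^n$ with time step $\tau>0$ between consecutive snapshots, form the $n\times m$ data matrices ($m\le n$) $$\boldsymbol{X}_1=[\hat{\boldsymbol{y}}_1,\dots,\hat{\boldsymbol{y}}_m],\qquad\boldsymbol{X}_2=[\imath\delta_t\boldsymbol{y}_1,\dots,\imath\delta_t\boldsymbol{y}_m],$$ where $\hat{\boldsymbol{y}}_k=\frac{\boldsymbol{y}_{k+1}+\boldsymbol{y}_{k-1}}{2}$ and $\delta_t\boldsymbol{y}_k=\frac{\boldsymbol{y}_{k+1}-\boldsymbol{y}_{k-1}}{2\tau}$. The matrix $\boldsymbol{A}^{\mathrm{SI}}$ is the minimal-Frobenius-norm solution of the Hermitian Procrustes problem $\min_{\boldsymbol{A}=\boldsymbol{A}^*}\|\boldsymbol{X}_2-\boldsymbol{A}\boldsymbol{X}_1\|_{\mathrm F}$ over $\boldsymbol{A}\in\mathbb{C}^{n\times n}$. In particular $\boldsymbol{A}^{\mathrm{SI}}$ is Hermitian. *)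

theory Defs
  imports "HOL-Analysis.Analysis"
begin

text \<open>
  The instance of \<^const>\<open>norm\<close> on \<^typ>\<open>complex ^ 'n\<close> is the Euclidean norm, and on
  \<^typ>\<open>complex ^ 'm ^ 'n\<close> (the matrices with \<open>CARD('n)\<close> rows and \<open>CARD('m)\<close> columns)
  it is the Frobenius norm.
\<close>

definition conj_transpose :: "complex ^ 'm ^ 'n \<Rightarrow> complex ^ 'n ^ 'm" where
  "conj_transpose A = (\<chi> i j. cnj (A $ j $ i))"

definition hermitian :: "complex ^ 'n ^ 'n \<Rightarrow> bool" where
  "hermitian A \<longleftrightarrow> A = conj_transpose A"

definition hermitian_procrustes_solution ::
    "complex ^ 'm ^ 'n \<Rightarrow> complex ^ 'm ^ 'n \<Rightarrow> complex ^ 'n ^ 'n \<Rightarrow> bool" where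
  "hermitian_procrustes_solution X1 X2 A \<longleftrightarrow>
     hermitian A \<and> (\<forall>B. hermitian B \<longrightarrow> norm (X2 - A ** X1) \<le> norm (X2 - B ** X1))"

definition min_norm_procrustes_solution ::
    "complex ^ 'm ^ 'n \<Rightarrow> complex ^ 'm ^ 'n \<Rightarrow> complex ^ 'n ^ 'n \<Rightarrow> bool" where
  "min_norm_procrustes_solution X1 X2 A \<longleftrightarrow>
     hermitian_procrustes_solution X1 X2 A \<and>
     (\<forall>B. hermitian_procrustes_solution X1 X2 B \<longrightarrow> norm A \<le> norm B)"

text \<open>The minimiser exists and is unique, so the definite description below is proper.\<close>

lemma min_norm_procrustes_solution_ex1:
  fixes X1 X2 :: "complex ^ 'm ^ 'n"
  shows "\<exists>!A. min_norm_procrustes_solution X1 X2 A"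
proof -
  define H where "H = {A :: complex ^ 'n ^ 'n. hermitian A}"
  define f where "f = (\<lambda>A :: complex ^ 'n ^ 'n. A ** X1)"
  have lin: "linear f"
  proof (rule linearI)
    show "f (A + B) = f A + f B" for A B
      by (simp add: f_def matrix_matrix_mult_def vec_eq_iff sum.distrib distrib_right)
    show "f (r *\<^sub>R A) = r *\<^sub>R f A" for r A
      unfolding f_def by (rule scalar_matrix_assoc[symmetric])
  qed
  have sub: "subspace H"
  proof (rule subspaceI)
    have add: "conj_transpose (A + B) = conj_transpose A + conj_transpose B"
      and scale: "conj_transpose (r *\<^sub>R A) = r *\<^sub>R conj_transpose A"
      and zero: "conj_transpose 0 = 0" for A B :: "complex ^ 'n ^ 'n" and r
      by (simp_all add: conj_transpose_def vec_eq_iff)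
    show "0 \<in> H" by (simp add: H_def hermitian_def zero)
    show "A + B \<in> H" if "A \<in> H" "B \<in> H" for A B
      using that unfolding H_def hermitian_def mem_Collect_eq by (metis add)
    show "r *\<^sub>R A \<in> H" if "A \<in> H" for r A
      using that unfolding H_def hermitian_def mem_Collect_eq by (metis scale)
  qed
  have subf: "subspace (f ` H)"
    using lin sub by (rule linear_subspace_image)
  have "f ` H \<noteq> {}" using subspace_0[OF sub] by auto
  then obtain P where P: "P \<in> f ` H" "\<And>Q. Q \<in> f ` H \<Longrightarrow> dist X2 P \<le> dist X2 Q"
    using distance_attains_inf[OF closed_subspace[OF subf], of X2] by blast
  define S where "S = {A. hermitian_procrustes_solution X1 X2 A}"
  have S_iff: "A \<in> S \<longleftrightarrow> A \<in> H \<and> (\<forall>B\<in>H. dist X2 (f A) \<le> dist X2 (f B))" for A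
    by (simp add: S_def H_def f_def hermitian_procrustes_solution_def dist_norm)
  have S_eq: "S = H \<inter> f -` {P}"
  proof (intro equalityI subsetI)
    fix A assume A: "A \<in> S"
    have "f A = P"
    proof (rule any_closest_point_unique[OF subspace_imp_convex[OF subf] closed_subspace[OF subf]])
      show "f A \<in> f ` H" using A unfolding S_iff by (intro imageI) (rule conjunct1)
      show "P \<in> f ` H" by (rule P(1))
      show "\<forall>z\<in>f ` H. dist X2 (f A) \<le> dist X2 z" using A unfolding S_iff by blast
      show "\<forall>z\<in>f ` H. dist X2 P \<le> dist X2 z" using P(2) by blast
    qed
    with A show "A \<in> H \<inter> f -` {P}" unfolding S_iff by blast
  next
    fix A assume "A \<in> H \<inter> f -` {P}"
    then have "A \<in> H" "f A = P" by blast+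
    then show "A \<in> S" unfolding S_iff using P(2) by blast
  qed
  have "continuous_on UNIV f"
    using lin by (simp add: linear_conv_bounded_linear linear_continuous_on)
  then have "closed (f -` {P})"
    using continuous_on_closed_vimage[OF closed_UNIV] closed_singleton by (metis Int_UNIV_right)
  then have cl: "closed S"
    unfolding S_eq by (rule closed_Int[OF closed_subspace[OF sub]])
  have cv: "convex S"
    unfolding S_eq
    by (rule convex_Int[OF subspace_imp_convex[OF sub] convex_linear_vimage[OF lin convex_singleton]])
  have ne: "S \<noteq> {}" using P(1) S_eq by blast
  obtain A where A: "A \<in> S" "\<And>B. B \<in> S \<Longrightarrow> dist 0 A \<le> dist 0 B"
    using distance_attains_inf[OF cl ne, of 0] by blast
  have min_iff: "min_norm_procrustes_solution X1 X2 B \<longleftrightarrow>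
      B \<in> S \<and> (\<forall>C\<in>S. dist 0 B \<le> dist 0 C)" for B
    by (simp add: min_norm_procrustes_solution_def S_def)
  show ?thesis
  proof (rule ex1I[of _ A])
    show "min_norm_procrustes_solution X1 X2 A"
      unfolding min_iff using A by blast
    fix B assume "min_norm_procrustes_solution X1 X2 B"
    then have B: "B \<in> S" "\<forall>C\<in>S. dist 0 B \<le> dist 0 C"
      unfolding min_iff by blast+
    have "\<forall>C\<in>S. dist 0 A \<le> dist 0 C" using A(2) by blast
    then show "B = A"
      by (rule any_closest_point_unique[OF cv cl B(1) A(1) B(2)])
  qed
qed

text \<open>
  The snapshots are \<open>y 0, \<dots>, y (CARD('m) + 1)\<close>; further values of \<open>y\<close> are not used.
  The linear order on \<open>'m\<close> is the order of the columns: \<open>column_number\<close> is its increasing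
  bijection onto \<open>{1..CARD('m)}\<close>, so a type variable \<open>'m\<close> stands for an arbitrary
  number of columns.
\<close>

definition column_number :: "'m::{finite,linorder} \<Rightarrow> nat" where
  "column_number j = card {..j}"

definition snapshot_average :: "(nat \<Rightarrow> complex ^ 'n) \<Rightarrow> nat \<Rightarrow> complex ^ 'n" where
  "snapshot_average y k = (1 / 2) *\<^sub>R (y (k + 1) + y (k - 1))"

definition snapshot_difference :: "real \<Rightarrow> (nat \<Rightarrow> complex ^ 'n) \<Rightarrow> nat \<Rightarrow> complex ^ 'n" where
  "snapshot_difference \<tau> y k = (1 / (2 * \<tau>)) *\<^sub>R (y (k + 1) - y (k - 1))"

definition data_matrix1 :: "(nat \<Rightarrow> complex ^ 'n) \<Rightarrow> complex ^ 'm::{finite,linorder} ^ 'n" where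
  "data_matrix1 y = (\<chi> i j. snapshot_average y (column_number j) $ i)"

definition data_matrix2 ::
    "real \<Rightarrow> (nat \<Rightarrow> complex ^ 'n) \<Rightarrow> complex ^ 'm::{finite,linorder} ^ 'n" where
  "data_matrix2 \<tau> y = (\<chi> i j. \<i> * snapshot_difference \<tau> y (column_number j) $ i)"

text \<open>The type argument carries the number of columns, which is not determined by \<open>y\<close>.\<close>

definition si_dmd_matrix ::
    "'m::{finite,linorder} itself \<Rightarrow> real \<Rightarrow> (nat \<Rightarrow> complex ^ 'n) \<Rightarrow> complex ^ 'n ^ 'n" where
  "si_dmd_matrix _ \<tau> y =
     (THE A. min_norm_procrustes_solution
        (data_matrix1 y :: complex ^ 'm::{finite,linorder} ^ 'n) (data_matrix2 \<tau> y) A)"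

definition scale_matrix :: "complex \<Rightarrow> complex ^ 'm ^ 'n \<Rightarrow> complex ^ 'm ^ 'n"
    (infixr \<open>*\<^sub>m\<close> 75) where
  "c *\<^sub>m A = (\<chi> i j. c * A $ i $ j)"

definition si_dmd_iterates :: "real \<Rightarrow> complex ^ 'n ^ 'n \<Rightarrow> (nat \<Rightarrow> complex ^ 'n) \<Rightarrow> bool" where
  "si_dmd_iterates \<tau> A x \<longleftrightarrow>
     (\<forall>k\<ge>1. x (k + 1) =
        (matrix_inv (mat 1 + (\<i> * complex_of_real \<tau>) *\<^sub>m A)
           ** (mat 1 - (\<i> * complex_of_real \<tau>) *\<^sub>m A)) *v x (k - 1))"

definition quadratic_energy :: "complex ^ 'n ^ 'n \<Rightarrow> complex ^ 'n \<Rightarrow> complex" where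
  "quadratic_energy A x = (\<Sum>i\<in>UNIV. cnj (x $ i) * (A *v x) $ i)"

end

theory Submission
  imports Defs
begin

text \<open>
  One step \<open>v \<mapsto> w\<close> satisfies \<open>w - v = - \<i>\<tau> A (w + v)\<close>. Polarising the quadratic form of a
  Hermitian matrix \<open>B\<close> at \<open>w - v\<close> and \<open>w + v\<close>, the difference of its values at \<open>w\<close> and \<open>v\<close>
  is a multiple of the quadratic form of \<open>A B - B A\<close> at \<open>w + v\<close>. So the form of every Hermitian
  \<open>B\<close> commuting with \<open>A\<close> is conserved; \<open>B = I\<close> gives the mass and \<open>B = A\<close> the energy.
\<close>

text \<open>The Hermitian inner product, conjugate-linear in its first argument;
  \<open>inner\<close> on this type is only its real part.\<close>

definition cdot :: "complex ^ 'n \<Rightarrow> complex ^ 'n \<Rightarrow> complex" where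
  "cdot u v = (\<Sum>i\<in>UNIV. cnj (u $ i) * v $ i)"

lemma cdot_add_left: "cdot (u + v) w = cdot u w + cdot v w"
  by (simp add: cdot_def sum.distrib distrib_right)

lemma cdot_add_right: "cdot u (v + w) = cdot u v + cdot u w"
  by (simp add: cdot_def sum.distrib distrib_left)

lemma cdot_diff_left: "cdot (u - v) w = cdot u w - cdot v w"
  by (simp add: cdot_def sum_subtractf left_diff_distrib)

lemma cdot_diff_right: "cdot u (v - w) = cdot u v - cdot u w"
  by (simp add: cdot_def sum_subtractf right_diff_distrib)

lemma cdot_scale_left: "cdot (c *s u) v = cnj c * cdot u v"
  by (simp add: cdot_def sum_distrib_left mult.assoc)

lemma cdot_scale_right: "cdot u (c *s v) = c * cdot u v"
  by (simp add: cdot_def sum_distrib_left mult.left_commute)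

lemma cnj_cdot: "cnj (cdot u v) = cdot v u"
  by (simp add: cdot_def mult.commute)

lemma cdot_self: "cdot v v = complex_of_real ((norm v)\<^sup>2)"
proof -
  have "cdot v v = (\<Sum>i\<in>UNIV. complex_of_real ((norm (v $ i))\<^sup>2))"
    unfolding cdot_def by (intro sum.cong refl) (metis complex_norm_square mult.commute)
  also have "\<dots> = complex_of_real ((norm v)\<^sup>2)"
    by (simp add: norm_vec_def L2_set_def sum_nonneg)
  finally show ?thesis .
qed

lemma cdot_conj_transpose: "cdot (A *v u) v = cdot u (conj_transpose A *v v)"
proof -
  have "cdot (A *v u) v = (\<Sum>i\<in>UNIV. \<Sum>j\<in>UNIV. cnj (u $ j) * (cnj (A $ i $ j) * v $ i))"
    by (simp add: cdot_def matrix_vector_mult_def sum_distrib_left sum_distrib_right mult_ac)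
  also have "\<dots> = (\<Sum>j\<in>UNIV. \<Sum>i\<in>UNIV. cnj (u $ j) * (cnj (A $ i $ j) * v $ i))"
    by (rule sum.swap)
  finally show ?thesis
    by (simp add: cdot_def conj_transpose_def matrix_vector_mult_def sum_distrib_left)
qed

lemma cdot_hermitian:
  assumes "hermitian A"
  shows "cdot (A *v u) v = cdot u (A *v v)"
  using assms cdot_conj_transpose[of A u v] unfolding hermitian_def by simp

lemma hermitian_mat_1: "hermitian (mat 1)"
  by (auto simp: hermitian_def conj_transpose_def mat_def vec_eq_iff)

lemma quadratic_energy_eq_cdot: "quadratic_energy A v = cdot v (A *v v)"
  by (simp add: quadratic_energy_def cdot_def)

lemma quadratic_energy_mat_1: "quadratic_energy (mat 1) v = complex_of_real ((norm v)\<^sup>2)"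
  by (simp add: quadratic_energy_eq_cdot cdot_self)

lemma scale_matrix_vector_mult: "(c *\<^sub>m A) *v v = c *s (A *v v)"
  by (simp add: scale_matrix_def matrix_vector_mult_def vec_eq_iff sum_distrib_left mult.assoc)

lemma matrix_inv_right:
  fixes A :: "'a::semiring_1 ^ 'n ^ 'm"
  assumes "invertible A"
  shows "A ** matrix_inv A = mat 1"
  using assms someI_ex[of "\<lambda>B. A ** B = mat 1 \<and> B ** A = mat 1"]
  unfolding invertible_def matrix_inv_def by blast

text \<open>The kernel is trivial: pairing a kernel vector \<open>v\<close> with itself gives the
  square of its norm plus \<i>\<tau> times \<open>cdot v (A *v v)\<close>. For Hermitian
  \<open>A\<close> the latter number is real, so the real part of the equation is the squared norm
  alone.\<close>

lemma invertible_mat_1_plus_imaginary_hermitian: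
  fixes A :: "complex ^ 'n ^ 'n"
  assumes "hermitian A"
  shows "invertible (mat 1 + (\<i> * complex_of_real \<tau>) *\<^sub>m A)"
proof -
  have "v = 0" if "(mat 1 + (\<i> * complex_of_real \<tau>) *\<^sub>m A) *v v = 0" for v :: "complex ^ 'n"
  proof -
    have "v + (\<i> * complex_of_real \<tau>) *s (A *v v) = 0"
      using that by (simp add: matrix_vector_mult_add_rdistrib scale_matrix_vector_mult)
    then have "cdot v (v + (\<i> * complex_of_real \<tau>) *s (A *v v)) = 0"
      by (simp add: cdot_def)
    then have "complex_of_real ((norm v)\<^sup>2) + \<i> * complex_of_real \<tau> * cdot v (A *v v) = 0"
      by (simp only: cdot_add_right cdot_scale_right cdot_self)
    moreover have "Im (cdot v (A *v v)) = 0"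
      using cnj_cdot[of v "A *v v"] cdot_hermitian[OF assms, of v v]
      by (simp add: complex_eq_iff)
    ultimately have "(norm v)\<^sup>2 = 0"
      by (simp add: complex_eq_iff)
    then show ?thesis by simp
  qed
  then show ?thesis
    by (auto simp: invertible_left_inverse matrix_left_invertible_ker)
qed

lemma quadratic_energy_cayley_step:
  fixes A B :: "complex ^ 'n ^ 'n" and \<tau> :: real
  assumes A: "hermitian A" and B: "hermitian B" and comm: "A ** B = B ** A"
  defines "c \<equiv> \<i> * complex_of_real \<tau>"
  shows "quadratic_energy B ((matrix_inv (mat 1 + c *\<^sub>m A) ** (mat 1 - c *\<^sub>m A)) *v v)
           = quadratic_energy B v"
proof -
  define w where "w = (matrix_inv (mat 1 + c *\<^sub>m A) ** (mat 1 - c *\<^sub>m A)) *v v"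
  define s where "s = w + v"
  have "invertible (mat 1 + c *\<^sub>m A)"
    unfolding c_def by (rule invertible_mat_1_plus_imaginary_hermitian[OF A])
  \<comment> \<open>Multiplying by the invertible factor removes \<open>matrix_inv\<close> and
    leaves the implicit form of the step.\<close>
  then have "(mat 1 + c *\<^sub>m A) *v w = (mat 1 - c *\<^sub>m A) *v v"
    unfolding w_def matrix_vector_mul_assoc matrix_mul_assoc
    by (simp add: matrix_inv_right)
  then have "w + c *s (A *v w) = v - c *s (A *v v)"
    by (simp add: matrix_vector_mult_add_rdistrib matrix_vector_mult_diff_rdistrib
        scale_matrix_vector_mult)
  then have "w - v = - c *s (A *v s)"
    by (simp add: s_def matrix_vector_right_distrib vector_add_ldistrib algebra_simps)
  then have "cdot (w - v) (B *v s) + cdot (B *v s) (w - v)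
      = - cnj c * cdot (A *v s) (B *v s) - c * cdot (B *v s) (A *v s)"
    by (simp only: cdot_scale_left cdot_scale_right) simp
  \<comment> \<open>Since \<tau> is real, \<open>c\<close> is purely imaginary and
    \<open>- cnj c = c\<close>; this sign turns the sum of the two terms into a commutator.\<close>
  also have "\<dots> = c * (cdot s ((A ** B) *v s) - cdot s ((B ** A) *v s))"
    by (simp add: cdot_hermitian A B matrix_vector_mul_assoc c_def algebra_simps)
  also have "\<dots> = 0"
    by (simp add: comm)
  finally have "cdot (w - v) (B *v s) + cdot (B *v s) (w - v) = 0" .
  \<comment> \<open>After expansion the mixed terms in \<open>w\<close> and \<open>v\<close> cancel,
    because \<open>B\<close> may be moved across \<open>cdot\<close>.\<close>
  moreover have "cdot (w - v) (B *v s) + cdot (B *v s) (w - v)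
      = 2 * (quadratic_energy B w - quadratic_energy B v)"
    by (simp add: s_def quadratic_energy_eq_cdot cdot_hermitian[OF B] matrix_vector_right_distrib
        matrix_vector_mult_diff_distrib cdot_add_left cdot_add_right cdot_diff_left cdot_diff_right)
  ultimately show ?thesis
    by (simp add: w_def)
qed

text \<open>The recursion joins indices two apart, so the even and odd iterates form separate
  orbits; \<open>r\<close> is the index at which an orbit starts.\<close>

lemma quadratic_energy_si_dmd_iterates:
  assumes "hermitian A" "hermitian B" "A ** B = B ** A" and iter: "si_dmd_iterates \<tau> A x"
  shows "quadratic_energy B (x (2 * k + r)) = quadratic_energy B (x r)"
proof (induction k)
  case (Suc k)
  have "x (2 * Suc k + r) = (matrix_inv (mat 1 + (\<i> * complex_of_real \<tau>) *\<^sub>m A)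
      ** (mat 1 - (\<i> * complex_of_real \<tau>) *\<^sub>m A)) *v x (2 * k + r)"
    \<comment> \<open>The recursion is taken at its middle index, which is at least 1, so the
      subtraction in \<open>k - 1\<close> is not truncated.\<close>
    using iter[unfolded si_dmd_iterates_def, rule_format, of "2 * k + r + 1"] by simp
  then show ?case
    using quadratic_energy_cayley_step[OF assms(1-3)] Suc by simp
qed simp

text \<open>Existence and uniqueness of the minimiser let \<open>THE\<close> satisfy its defining
  property, which includes the Hermitian constraint.\<close>

lemma hermitian_si_dmd_matrix: "hermitian (si_dmd_matrix TYPE('m::{finite,linorder}) \<tau> y)"
proof -
  have "min_norm_procrustes_solution (data_matrix1 y :: complex ^ 'm::{finite,linorder} ^ _)
      (data_matrix2 \<tau> y) (si_dmd_matrix TYPE('m) \<tau> y)"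
    unfolding si_dmd_matrix_def by (rule theI'[OF min_norm_procrustes_solution_ex1])
  then show ?thesis
    unfolding min_norm_procrustes_solution_def hermitian_procrustes_solution_def by blast
qed

theorem theorem3p6:
  fixes \<tau> :: real
    and y x :: "nat \<Rightarrow> complex ^ 'n"
    and A :: "complex ^ 'n ^ 'n"
  assumes "\<tau> > 0"
    and "CARD('m::{finite,linorder}) \<le> CARD('n)"
    and "A = si_dmd_matrix TYPE('m) \<tau> y"
    and "si_dmd_iterates \<tau> A x"
  shows "(\<forall>k. norm (x (2 * k)) = norm (x 0) \<and> norm (x (2 * k + 1)) = norm (x 1)) \<and>
         (\<forall>k. quadratic_energy A (x (2 * k)) = quadratic_energy A (x 0) \<and>
              quadratic_energy A (x (2 * k + 1)) = quadratic_energy A (x 1))"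
proof -
  have A: "hermitian A"
    unfolding assms(3) by (rule hermitian_si_dmd_matrix)
  have energy: "quadratic_energy A (x (2 * k + r)) = quadratic_energy A (x r)" for k r
    by (rule quadratic_energy_si_dmd_iterates[OF A A refl assms(4)])
  have mass: "norm (x (2 * k + r)) = norm (x r)" for k r
  proof -
    have "A ** mat 1 = mat 1 ** A" by simp
    from quadratic_energy_si_dmd_iterates[OF A hermitian_mat_1 this assms(4), of k r]
    \<comment> \<open>The energies for the identity are squared norms embedded in the complex
      numbers; the embedding is injective, and norms are nonnegative.\<close>
    have "(norm (x (2 * k + r)))\<^sup>2 = (norm (x r))\<^sup>2"
      unfolding quadratic_energy_mat_1 of_real_eq_iff .
    then show ?thesis by simp
  qed
  show ?thesis
    using energy[of _ 0] energy[of _ 1] mass[of _ 0] mass[of _ 1] by simp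
qed

end
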